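(* For every positive integer $n$ and every non-negative integer $a$, $$\sum_{d \mid n} Ns(a,d) = \begin{cases} n, & \text{if } n \mid a,\\ 0, & \text{otherwise},\end{cases}$$ where the sum is extended over all positive divisors $d$ of $n$.
   Context: For a positive integer $n$ and a non-negative integer $a$, define $$Ns(a,n) = \varphi(n)\,\frac{\mu\left(\frac{n}{(a,n)}\right)}{\varphi\left(\frac{n}{(a,n)}\right)},$$ where $\varphi$ is the Euler function, $\mu$ is the M\"obius function and $(a,n)$ is the greatest common divisor of $a$ and $n$ (with $(0,n)=n$). *)

theory Defs
  imports "HOL-Number_Theory.Number_Theory" "HOL-Computational_Algebra.Squarefree"
begin

text \<open>The Moebius function; its value at 0 is the junk value 0, as 0 is not squarefree.\<close>

definition moebius :: "nat \<Rightarrow> int" where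
  "moebius n = (if squarefree n then (-1) ^ card (prime_factors n) else 0)"

text \<open>The division of \<open>n\<close> by the gcd is exact, whereas the quotient of the Moebius value by the
  totient is a proper fraction in general, so the value is taken in the reals.
  Note that \<open>gcd 0 n = n\<close> holds in the library.\<close>

definition Ns :: "nat \<Rightarrow> nat \<Rightarrow> real" where
  "Ns a n = real (totient n) *
     (real_of_int (moebius (n div gcd a n)) / real (totient (n div gcd a n)))"

end

theory Submission
  imports Defs
begin

text \<open>
  For fixed \<open>a\<close> the function \<open>Ns a\<close> is multiplicative, because totient, Moebius function
  and \<open>gcd a\<close> all are (\<open>Ns_mult_coprime\<close>). Hence its divisor sum is multiplicative too
  (\<open>sum_divisors_mult_coprime\<close>), and so is the right-hand side, as \<open>m * n\<close> divides \<open>a\<close> iff both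
  coprime factors do. The identity thus reduces to prime powers (\<open>sum_Ns_prime_power\<close>).

  Along the powers \<open>p ^ i\<close> of a prime, \<open>Ns a (p ^ i)\<close> is \<open>totient (p ^ i)\<close> as long as
  \<open>p ^ i\<close> divides \<open>a\<close>, so that the partial sums telescope to \<open>p ^ i\<close>. At the first power that fails
  to divide \<open>a\<close>, the value is \<open>- p ^ (i - 1)\<close>, which cancels everything collected so far. From then on
  the argument of the Moebius function is divisible by \<open>p\<^sup>2\<close> and all values vanish.
\<close>

section \<open>Multiplicativity\<close>

lemma gcd_mult_right_coprime:
  fixes a m n :: nat
  assumes "coprime m n"
  shows "gcd a (m * n) = gcd a m * gcd a n"
proof (rule dvd_antisym)
  obtain b c where bc: "gcd a (m * n) = b * c" "b dvd m" "c dvd n"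
    using division_decomp[of "gcd a (m * n)" m n] by auto
  have "b * c dvd a"
    by (metis bc(1) gcd_dvd1)
  then have "b dvd a" "c dvd a"
    by (auto dest: dvd_mult_left dvd_mult_right)
  with bc show "gcd a (m * n) dvd gcd a m * gcd a n"
    by (simp add: mult_dvd_mono)
next
  have "coprime (gcd a m) (gcd a n)"
    using assms by (meson coprime_divisors gcd_dvd2)
  then have "gcd a m * gcd a n dvd a"
    by (simp add: divides_mult)
  then show "gcd a m * gcd a n dvd gcd a (m * n)"
    by (simp add: mult_dvd_mono)
qed

lemma moebius_mult_coprime:
  assumes "coprime m n"
  shows "moebius (m * n) = moebius m * moebius n"
proof (cases "squarefree m \<and> squarefree n")
  case True
  then have "m \<noteq> 0" "n \<noteq> 0"
    by (metis not_squarefree_0)+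
  moreover have "prime_factors m \<inter> prime_factors n = {}"
    using assms coprime_common_divisor[of m n] not_prime_unit
    by (meson disjoint_iff in_prime_factors_imp_dvd in_prime_factors_imp_prime)
  ultimately have "card (prime_factors (m * n)) = card (prime_factors m) + card (prime_factors n)"
    by (simp add: prime_factors_product card_Un_disjoint)
  with True assms show ?thesis
    by (simp add: moebius_def squarefree_mult_coprime power_add)
next
  case False
  then show ?thesis
    by (auto simp: moebius_def dest: squarefree_multD)
qed

lemma Ns_mult_coprime:
  assumes "coprime m n"
  shows "Ns a (m * n) = Ns a m * Ns a n"
proof -
  have "coprime (m div gcd a m) (n div gcd a n)"
    using assms by (rule coprime_divisors[rotated 2]) (metis dvd_mult_div_cancel dvd_triv_right gcd_dvd2)+
  moreover have "m * n div gcd a (m * n) = (m div gcd a m) * (n div gcd a n)"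
    by (simp add: gcd_mult_right_coprime[OF assms] div_mult_div_if_dvd)
  ultimately show ?thesis
    by (simp add: Ns_def assms moebius_mult_coprime totient_mult_coprime)
qed

text \<open>The divisors of \<open>m * n\<close> are uniquely the products of a divisor of \<open>m\<close> and a divisor of \<open>n\<close>;
  the two factors are recovered by taking the gcd with \<open>m\<close> and with \<open>n\<close>.\<close>

lemma sum_divisors_mult_coprime:
  fixes f :: "nat \<Rightarrow> 'a :: comm_semiring_1"
  assumes "coprime m n"
    and mult: "\<And>x y. coprime x y \<Longrightarrow> f (x * y) = f x * f y"
  shows "(\<Sum>d | d dvd m * n. f d) = (\<Sum>d | d dvd m. f d) * (\<Sum>d | d dvd n. f d)"
proof -
  have gcd_left: "gcd (x * y) m = x" if "x dvd m" "y dvd n" for x y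
  proof -
    have "coprime y m"
      using assms(1) that(2) by (meson coprime_commute coprime_divisors dvd_refl)
    then show ?thesis
      using that(1) by (metis coprime_commute gcd.commute gcd_mult_right_right_cancel gcd_nat.absorb_iff1)
  qed
  have gcd_right: "gcd (x * y) n = y" if "x dvd m" "y dvd n" for x y
  proof -
    have "coprime x n"
      using assms(1) that(1) by (meson coprime_divisors dvd_refl)
    then show ?thesis
      using that(2) by (metis coprime_commute gcd.commute gcd_mult_right_left_cancel gcd_nat.absorb_iff1)
  qed
  have "(\<Sum>d | d dvd m. f d) * (\<Sum>d | d dvd n. f d)
      = (\<Sum>(x, y)\<in>{d. d dvd m} \<times> {d. d dvd n}. f x * f y)"
    by (simp add: sum_product sum.cartesian_product)
  also have "\<dots> = (\<Sum>d | d dvd m * n. f d)"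
  proof (rule sum.reindex_bij_witness
      [where j = "\<lambda>(x, y). x * y" and i = "\<lambda>d. (gcd d m, gcd d n)"])
    fix xy assume "xy \<in> {d. d dvd m} \<times> {d. d dvd n}"
    then obtain x y where xy: "xy = (x, y)" "x dvd m" "y dvd n"
      by blast
    show "(gcd (case xy of (x, y) \<Rightarrow> x * y) m, gcd (case xy of (x, y) \<Rightarrow> x * y) n) = xy"
      by (simp only: xy prod.case gcd_left[OF xy(2,3)] gcd_right[OF xy(2,3)])
    show "(case xy of (x, y) \<Rightarrow> x * y) \<in> {d. d dvd m * n}"
      using xy by (simp add: mult_dvd_mono)
    have "coprime x y"
      using coprime_divisors[OF xy(2,3) assms(1)] .
    then show "f (case xy of (x, y) \<Rightarrow> x * y) = (case xy of (x, y) \<Rightarrow> f x * f y)"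
      by (simp only: xy prod.case mult)
  next
    fix d assume "d \<in> {d. d dvd m * n}"
    then have "gcd d (m * n) = d"
      by (simp only: mem_Collect_eq gcd_nat.absorb1)
    then show "(case (gcd d m, gcd d n) of (x, y) \<Rightarrow> x * y) = d"
      by (simp only: prod.case gcd_mult_right_coprime[OF assms(1)])
    show "(gcd d m, gcd d n) \<in> {d. d dvd m} \<times> {d. d dvd n}"
      by simp
  qed
  finally show ?thesis ..
qed

section \<open>Prime powers\<close>

lemma Ns_eq_totient_if_dvd:
  assumes "n dvd a" "n > 0"
  shows "Ns a n = real (totient n)"
  using assms by (simp add: Ns_def moebius_def gcd_nat.absorb2)

text \<open>Here the gcd of \<open>a\<close> and \<open>p ^ Suc k\<close> is exactly \<open>p ^ k\<close>, so the Moebius function is evaluated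
  at \<open>p\<close>, and the factor \<open>p - 1\<close> of the totient of \<open>p ^ Suc k\<close> cancels against the totient of \<open>p\<close>.\<close>

lemma Ns_prime_power_Suc_first_nondivisor:
  assumes "prime p" "p ^ k dvd a" "\<not> p ^ Suc k dvd a"
  shows "Ns a (p ^ Suc k) = - real (p ^ k)"
proof -
  obtain i where i: "i \<le> Suc k" "gcd a (p ^ Suc k) = p ^ i"
    using divides_primepow_nat[OF assms(1), of "gcd a (p ^ Suc k)" "Suc k"] by auto
  have "p ^ k dvd p ^ i"
    using assms(2) by (simp flip: i(2))
  then have "k \<le> i"
    using assms(1) by (simp add: dvd_power_iff_le prime_ge_2_nat)
  moreover have "i \<noteq> Suc k"
    using assms(3) i(2) by (metis gcd_dvd1)
  ultimately have "gcd a (p ^ Suc k) = p ^ k"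
    using i by (metis le_SucE le_antisym)
  moreover have "p ^ Suc k div p ^ k = p"
    using assms(1) by (simp add: prime_gt_0_nat)
  moreover have "moebius p = -1"
    using assms(1) by (simp add: moebius_def squarefree_prime prime_prime_factors)
  moreover have "p - 1 > 0"
    using assms(1) prime_gt_1_nat by simp
  ultimately show ?thesis
    unfolding Ns_def totient_prime_power_Suc[OF assms(1)]
    by (simp add: totient_prime[OF assms(1)] del: power_Suc)
qed

text \<open>The gcd of \<open>a\<close> and \<open>p ^ Suc k\<close> is now at most \<open>p ^ (k - 1)\<close>, which leaves a square factor
  \<open>p\<^sup>2\<close> in the argument of the Moebius function.\<close>

lemma Ns_prime_power_Suc_eq_0:
  assumes "prime p" "\<not> p ^ k dvd a"
  shows "Ns a (p ^ Suc k) = 0"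
proof -
  obtain i where i: "i \<le> Suc k" "gcd a (p ^ Suc k) = p ^ i"
    using divides_primepow_nat[OF assms(1), of "gcd a (p ^ Suc k)" "Suc k"] by auto
  then have "i < k"
    using assms(2) by (metis gcd_dvd1 le_imp_power_dvd dvd_trans not_less)
  then have "p ^ Suc k div p ^ i = p ^ (Suc k - i)" "Suc k - i > 1"
    using assms(1) by (auto simp: power_diff prime_gt_0_nat simp del: power_Suc)
  moreover have "\<not> squarefree (p ^ (Suc k - i))"
    using \<open>Suc k - i > 1\<close> assms(1) by (auto simp: squarefree_power_iff)
  ultimately show ?thesis
    by (simp add: Ns_def i(2) moebius_def del: power_Suc)
qed

lemma sum_Ns_prime_power:
  assumes "prime p"
  shows "(\<Sum>d | d dvd p ^ k. Ns a d) = (if p ^ k dvd a then real (p ^ k) else 0)"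
proof (induction k)
  case 0
  then show ?case
    using Ns_eq_totient_if_dvd[of 1 a] by simp
next
  case (Suc k)
  have "{d. d dvd p ^ Suc k} = insert (p ^ Suc k) {d. d dvd p ^ k}"
    using assms by (auto simp: divides_primepow_nat le_Suc_eq simp del: power_Suc)
  moreover have "\<not> p ^ Suc k dvd p ^ k"
    using assms by (simp add: dvd_power_iff_le prime_ge_2_nat del: power_Suc)
  moreover have "finite {d. d dvd p ^ k}"
    using assms by (intro finite_divisors_nat) (simp add: prime_gt_0_nat)
  ultimately have step: "(\<Sum>d | d dvd p ^ Suc k. Ns a d)
      = Ns a (p ^ Suc k) + (\<Sum>d | d dvd p ^ k. Ns a d)"
    by (simp del: power_Suc)
  consider "p ^ Suc k dvd a" | "p ^ k dvd a" "\<not> p ^ Suc k dvd a" | "\<not> p ^ k dvd a" "\<not> p ^ Suc k dvd a"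
    by (meson dvd_trans le_imp_power_dvd lessI less_imp_le)
  then show ?case
  proof cases
    case 1
    then have "p ^ k dvd a"
      by (meson dvd_trans le_imp_power_dvd lessI less_imp_le)
    moreover have "Ns a (p ^ Suc k) = real (p ^ k * (p - 1))"
      using 1 assms Ns_eq_totient_if_dvd[of "p ^ Suc k" a]
      by (simp add: prime_gt_0_nat totient_prime_power_Suc[OF assms] del: power_Suc)
    moreover have "p ^ k * (p - 1) + p ^ k = p ^ Suc k"
      using assms prime_gt_0_nat[of p] by (simp add: algebra_simps)
    ultimately show ?thesis
      using 1 by (simp add: step Suc.IH del: power_Suc flip: of_nat_add of_nat_mult of_nat_power)
  next
    case 2
    then show ?thesis
      by (simp add: step Suc.IH Ns_prime_power_Suc_first_nondivisor[OF assms] del: power_Suc)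
  next
    case 3
    then show ?thesis
      by (simp add: step Suc.IH Ns_prime_power_Suc_eq_0[OF assms] del: power_Suc)
  qed
qed

section \<open>The divisor sum\<close>

theorem theorem1:
  fixes n a :: nat
  assumes "n > 0"
  shows "(\<Sum>d | d dvd n. Ns a d) = (if n dvd a then real n else 0)"
  using assms
proof (induction n rule: less_induct)
  case (less n)
  show ?case
  proof (cases "n = 1")
    case True
    then show ?thesis
      using Ns_eq_totient_if_dvd[of 1 a] by simp
  next
    case False
    then obtain p where p: "prime p" "p dvd n"
      using prime_factor_nat by blast
    have "\<not> is_unit p"
      using p(1) not_prime_unit by blast
    \<comment> \<open>Splitting off the full power of \<open>p\<close> at once keeps the cofactor coprime to it.\<close>
    then obtain m where m: "n = p ^ multiplicity p n * m" "\<not> p dvd m"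
      using less.prems by (metis multiplicity_decompose' not_gr_zero)
    define k where "k = multiplicity p n"
    have n: "n = p ^ k * m"
      using m(1) by (simp add: k_def)
    have "m > 0"
      using less.prems n by (cases m) auto
    have "k > 0"
      using p m(2) n by (cases k) auto
    then have "p ^ k > 1"
      using prime_gt_1_nat[OF p(1)] by (simp only: one_less_power)
    then have "m < n"
      using n \<open>m > 0\<close> by simp
    have cop: "coprime (p ^ k) m"
      using p(1) m(2) by (simp add: prime_imp_coprime)
    have "(\<Sum>d | d dvd n. Ns a d) = (\<Sum>d | d dvd p ^ k. Ns a d) * (\<Sum>d | d dvd m. Ns a d)"
      unfolding n using cop Ns_mult_coprime[of _ _ a]
      by (rule sum_divisors_mult_coprime[where f = "Ns a"])
    also have "\<dots> = (if p ^ k dvd a then real (p ^ k) else 0) * (if m dvd a then real m else 0)"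
      using less.IH[OF \<open>m < n\<close> \<open>m > 0\<close>] sum_Ns_prime_power[OF p(1)] by simp
    also have "\<dots> = (if n dvd a then real n else 0)"
    proof -
      have "n dvd a \<longleftrightarrow> p ^ k dvd a \<and> m dvd a"
        unfolding n using cop by (meson divides_mult dvd_mult_left dvd_mult_right)
      moreover have "real n = real (p ^ k) * real m"
        by (subst n) (rule of_nat_mult)
      ultimately show ?thesis
        by simp
    qed
    finally show ?thesis .
  qed
qed

end
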